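(* Let $p_{\mathbf X}$ (the target density) and $\tilde p_{\mathbf X}$ (the surrogate density) be probability densities on $\mathbb{R}^{n\times T}$, and let $p_{\mathbf Y\mid\mathbf X}(\mathbf y\mid\mathbf x)$ be a conditional probability density for an observation $\mathbf y\in\mathbb{R}^{m\times T}$ given $\mathbf x\in\mathbb{R}^{n\times T}$. Define the densities $$p_{\mathbf Y}(\mathbf y)=\int p_{\mathbf Y\mid\mathbf X}(\mathbf y\mid\mathbf x)\,p_{\mathbf X}(\mathbf x)\,d\mathbf x,\qquad \hat p_{\mathbf Y}(\mathbf y)=\int p_{\mathbf Y\mid\mathbf X}(\mathbf y\mid\mathbf x)\,\tilde p_{\mathbf X}(\mathbf x)\,d\mathbf x,$$ $$\hat p_{\mathbf X\mid\mathbf Y}(\mathbf x\mid\mathbf y)=\frac{p_{\mathbf Y\mid\mathbf X}(\mathbf y\mid\mathbf x)\,\tilde p_{\mathbf X}(\mathbf x)}{\int p_{\mathbf Y\mid\mathbf X}(\mathbf y\mid\mathbf x')\,\tilde p_{\mathbf X}(\mathbf x')\,d\mathbf x'},\qquad \hat p_{\mathbf X}(\mathbf x)=\int \hat p_{\mathbf X\mid\mathbf Y}(\mathbf x\mid\mathbf y)\,p_{\mathbf Y}(\mathbf y)\,d\mathbf y.$$ Assume that for every $\mathbf x\in\mathbb{R}^{n\times T}$, $$\operatorname{supp}\bigl(p_{\mathbf Y\mid\mathbf X}(\cdot\mid\mathbf x)\,p_{\mathbf Y}(\cdot)\bigr)\subseteq\operatorname{supp}(\hat p_{\mathbf Y})\subseteq\operatorname{supp}(p_{\mathbf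 Y}),$$ and that $\mathrm{KL}(p_{\mathbf X},\tilde p_{\mathbf X})$ and $\mathrm{KL}(p_{\mathbf Y},\hat p_{\mathbf Y})$ are such that their difference is well defined. Then $$\mathrm{KL}(p_{\mathbf X},\hat p_{\mathbf X})\le \mathrm{KL}(p_{\mathbf X},\tilde p_{\mathbf X})-\mathrm{KL}(p_{\mathbf Y},\hat p_{\mathbf Y}).$$
   Context: All densities are with respect to Lebesgue measure, and $n,m,T$ are positive integers. For a nonnegative function $q$, $\operatorname{supp}(q)$ denotes the set of points where $q\neq 0$. The Kullback-Leibler distance between two densities $p$ and $q$ on the same space is $\mathrm{KL}(p,q)=\int p(\mathbf z)\log\frac{p(\mathbf z)}{q(\mathbf z)}\,d\mathbf z$. The quantity $\hat p_{\mathbf X\mid\mathbf Y}(\mathbf x\mid\mathbf y)$ is only used for those $\mathbf y$ with $p_{\mathbf Y}(\mathbf y)>0$. *)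

theory Defs
  imports "HOL-Analysis.Analysis"
begin

text \<open>
  Given densities are real-valued. Densities obtained from them by integration are
  \<^typ>\<open>ennreal\<close>-valued, because such an integral may be infinite on a null set.
\<close>

definition prob_density :: "('a::euclidean_space \<Rightarrow> real) \<Rightarrow> bool" where
  "prob_density f \<longleftrightarrow>
     f \<in> borel_measurable borel \<and> (\<forall>x. 0 \<le> f x) \<and> (\<integral>\<^sup>+x. ennreal (f x) \<partial>lborel) = 1"

text \<open>The argument order is that of the notation \<open>k(y | x)\<close>.\<close>

definition cond_density :: "('b::euclidean_space \<Rightarrow> 'a::euclidean_space \<Rightarrow> real) \<Rightarrow> bool" where
  "cond_density k \<longleftrightarrow>
     (\<lambda>(y, x). k y x) \<in> borel_measurable (borel \<Otimes>\<^sub>M borel) \<and> (\<forall>x. prob_density (\<lambda>y. k y x))"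

definition marginal ::
  "('b::euclidean_space \<Rightarrow> 'a::euclidean_space \<Rightarrow> real) \<Rightarrow> ('a \<Rightarrow> real) \<Rightarrow> 'b \<Rightarrow> ennreal" where
  "marginal k p y = (\<integral>\<^sup>+x. ennreal (k y x) * ennreal (p x) \<partial>lborel)"

definition posterior ::
  "('b::euclidean_space \<Rightarrow> 'a::euclidean_space \<Rightarrow> real) \<Rightarrow> ('a \<Rightarrow> real) \<Rightarrow> 'a \<Rightarrow> 'b \<Rightarrow> ennreal" where
  "posterior k q x y =
     ennreal (k y x) * ennreal (q x) / (\<integral>\<^sup>+x'. ennreal (k y x') * ennreal (q x') \<partial>lborel)"

text \<open>
  Where \<^term>\<open>marginal k p y = 0\<close> the integrand below is \<open>0\<close>, whatever the value of the
  posterior, so the posterior only matters for those \<open>y\<close> with positive marginal density.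
\<close>

definition averaged_posterior ::
  "('b::euclidean_space \<Rightarrow> 'a::euclidean_space \<Rightarrow> real) \<Rightarrow> ('a \<Rightarrow> real) \<Rightarrow> ('a \<Rightarrow> real) \<Rightarrow> 'a \<Rightarrow> ennreal"
where
  "averaged_posterior k q p x = (\<integral>\<^sup>+y. posterior k q x y * marginal k p y \<partial>lborel)"

definition ext_ln :: "ennreal \<Rightarrow> ereal" where
  "ext_ln a = (if a = 0 then -\<infinity> else if a = \<infinity> then \<infinity> else ereal (ln (enn2real a)))"

text \<open>
  Extended Lebesgue integral. It is meaningful unless both parts are infinite. In the
  Kullback-Leibler integral below the negative part is at most \<open>1\<close>, since
  \<open>p ln (p / q) \<ge> p - q\<close>.
\<close>

definition ext_integral :: "'a measure \<Rightarrow> ('a \<Rightarrow> ereal) \<Rightarrow> ereal" where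
  "ext_integral M f =
     enn2ereal (\<integral>\<^sup>+x. e2ennreal (f x) \<partial>M) - enn2ereal (\<integral>\<^sup>+x. e2ennreal (- f x) \<partial>M)"

text \<open>
  The usual conventions come from extended arithmetic: the integrand is \<open>0\<close> where \<open>p\<close>
  vanishes (as \<open>0 * (\<plusminus>\<infinity>) = 0\<close>) and \<open>\<infinity>\<close> where \<open>p\<close> is positive and \<open>q\<close> vanishes. The value may
  be \<open>\<infinity>\<close>, unlike that of the real-valued \<open>KL_divergence\<close> of HOL-Probability.
\<close>

definition KL :: "('a::euclidean_space \<Rightarrow> ennreal) \<Rightarrow> ('a \<Rightarrow> ennreal) \<Rightarrow> ereal" where
  "KL p q = ext_integral lborel (\<lambda>z. enn2ereal (p z) * ext_ln (p z / q z))"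

end

theory Submission
  imports Defs "HOL-Probability.Probability_Measure"
begin

text \<open>Let \<open>\<mu>\<close> be the joint law of \<open>(y, x)\<close> with density
  \<open>k y x * p x\<close>. Its marginals have densities \<open>P\<close> and \<open>p\<close>, so
  each Kullback-Leibler distance in question is the \<open>\<mu>\<close>-mean of a logarithm.
  Pulling \<open>q x\<close> out of the averaged posterior gives \<open>r = q * w\<close>, where
  \<open>w x\<close>, the integral of \<open>k y x * (P y / Q y)\<close> over \<open>y\<close>, is
  the conditional mean of \<open>P / Q\<close> given \<open>x\<close>. Formally, KL(p, q) - KL(p, r)
  is the mean of ln w and KL(P, Q) is the mean of ln (P / Q), so the claim is Jensen's inequality
  conditionally on \<open>x\<close>.

  The remaining work is to keep infinite values apart. \<open>nn_integral_neg_ext_ln_le\<close>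
  makes all negative parts finite, \<open>ext_integral_ext_ln_add_le\<close> carries out the
  logarithmic inequality on a probability space, and \<open>KL_averaged_posterior_le\<close>
  supplies \<open>\<mu>\<close> and the almost-everywhere facts that it needs.\<close>

section \<open>Extended arithmetic, and extended integrals under densities and image
  measures\<close>

lemma ennreal_mult_divide_le: "x * (y / x) \<le> (y :: ennreal)"
proof (cases "x = 0 \<or> x = top")
  case False
  then have "x * (y / x) = y * (x / x)"
    by (simp add: divide_ennreal_def mult_ac)
  with False show ?thesis
    by (simp add: less_top)
qed auto

lemma e2ennreal_enn2ereal_mult: "e2ennreal (enn2ereal p * x) = p * e2ennreal x"
proof (cases "0 \<le> x")
  case True
  then have "x = enn2ereal (e2ennreal x)"
    by (simp add: enn2ereal_e2ennreal)
  then show ?thesis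
    by (metis e2ennreal_enn2ereal times_ennreal.rep_eq)
next
  case False
  then have "enn2ereal p * x \<le> 0"
    by (simp add: ereal_mult_le_0_iff)
  with False show ?thesis
    by (simp add: e2ennreal_neg)
qed

lemma measurable_ext_ln [measurable]: "ext_ln \<in> borel_measurable borel"
  unfolding ext_ln_def[abs_def] by measurable

text \<open>The weight is nonnegative, so it passes through the positive and negative parts
  separately. With \<open>ext_integral_distr\<close>, this turns a \<open>KL\<close> into the mean
  of a log-ratio under the joint law.\<close>

lemma ext_integral_density:
  assumes [measurable]: "p \<in> borel_measurable M" "f \<in> borel_measurable M"
  shows "ext_integral (density M p) f = ext_integral M (\<lambda>z. enn2ereal (p z) * f z)"
  unfolding ext_integral_def
  by (simp add: nn_integral_density e2ennreal_enn2ereal_mult ereal_mult_minus_right[symmetric]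
      del: ereal_mult_minus_right)

lemma ext_integral_distr:
  assumes [measurable]: "g \<in> measurable M N" "f \<in> borel_measurable N"
  shows "ext_integral (distr M N g) f = ext_integral M (\<lambda>z. f (g z))"
  unfolding ext_integral_def by (simp add: nn_integral_distr)

section \<open>Finite negative parts of log-ratios\<close>

text \<open>This is \<open>p ln (s / p) \<le> s - p \<le> s\<close>. It also holds at the junk value \<open>\<infinity> / \<infinity> = 0\<close>.\<close>

lemma mult_neg_ext_ln_le: "p * e2ennreal (- ext_ln (p / s)) \<le> s"
proof (cases "p = 0 \<or> s = \<infinity> \<or> s = 0 \<or> p = \<infinity>")
  case True
  then consider "p = 0" | "s = \<infinity>" | "p \<noteq> 0" "s = 0" | "p = \<infinity>" "s \<noteq> \<infinity>" by blast
  then show ?thesis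
  proof cases
    case 3
    then show ?thesis by (simp add: ext_ln_def ennreal_divide_zero e2ennreal_neg)
  next
    case 4
    then show ?thesis by (simp add: ext_ln_def ennreal_top_divide e2ennreal_neg)
  qed auto
next
  case False
  then obtain a b where ab: "p = ennreal a" "s = ennreal b" "0 < a" "0 < b"
    by (cases p; cases s) (auto simp: less_le)
  then have "p / s = ennreal (a / b)"
    by (simp add: divide_ennreal)
  with ab have e: "e2ennreal (- ext_ln (p / s)) = ennreal (- ln (a / b))"
    by (simp add: ext_ln_def ennreal_eq_0_iff not_le)
  have "- ln (a / b) = ln (b / a)"
    using ab by (simp add: ln_div)
  also have "\<dots> \<le> b / a - 1"
    using ab by (intro ln_le_minus_one) simp
  finally have "a * - ln (a / b) \<le> a * (b / a - 1)"
    using ab by (intro mult_left_mono) auto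
  also have "\<dots> \<le> b"
    using ab by (simp add: field_simps)
  finally show ?thesis
    using ab unfolding e by (simp add: ennreal_mult'[symmetric] ennreal_leI)
qed

lemma nn_integral_neg_ext_ln_le:
  assumes [measurable]: "p \<in> borel_measurable M" "s \<in> borel_measurable M"
  shows "(\<integral>\<^sup>+z. e2ennreal (- ext_ln (p z / s z)) \<partial>density M p) \<le> (\<integral>\<^sup>+z. s z \<partial>M)"
  by (subst nn_integral_density) (auto intro!: nn_integral_mono mult_neg_ext_ln_le)

section \<open>From extended to real integrals, and the logarithmic inequality\<close>

text \<open>Agrees with \<open>ext_ln\<close> away from 0 and \<open>\<infinity>\<close>, so that
  almost-everywhere finite logarithms can be treated by real integration.\<close>

definition real_ln :: "ennreal \<Rightarrow> real" where
  "real_ln a = ln (enn2real a)"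

lemma measurable_real_ln [measurable]: "real_ln \<in> borel_measurable borel"
  unfolding real_ln_def[abs_def] by measurable

lemma ext_integral_ereal:
  assumes [measurable]: "f \<in> borel_measurable M" and "integrable M h" and "AE z in M. f z = ereal (h z)"
  shows "ext_integral M f = ereal (\<integral>z. h z \<partial>M)"
proof -
  have "(\<integral>\<^sup>+z. e2ennreal (f z) \<partial>M) = (\<integral>\<^sup>+z. ennreal (h z) \<partial>M)"
       "(\<integral>\<^sup>+z. e2ennreal (- f z) \<partial>M) = (\<integral>\<^sup>+z. ennreal (- h z) \<partial>M)"
    using assms(3) by (auto intro!: nn_integral_cong_AE)
  moreover have "enn2ereal X = ereal (enn2real X)" if "X \<noteq> \<infinity>" for X
    using that by (cases X) auto
  ultimately show ?thesis
    using assms(2) by (simp add: ext_integral_def real_lebesgue_integral_def real_integrable_def)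
qed

lemma integrable_sandwich:
  fixes l f u :: "_ \<Rightarrow> real"
  assumes [measurable]: "f \<in> borel_measurable M"
    and "(\<integral>\<^sup>+z. ennreal (- f z) \<partial>M) < \<infinity>"
    and u: "integrable M u" and le: "AE z in M. f z \<le> u z"
  shows "integrable M f"
proof -
  have "(\<integral>\<^sup>+z. ennreal (f z) \<partial>M) \<le> (\<integral>\<^sup>+z. ennreal (u z) \<partial>M)"
    using le by (intro nn_integral_mono_AE) (auto simp: ennreal_leI)
  also have "\<dots> < \<infinity>"
    using u by (auto simp: real_integrable_def less_top)
  finally show ?thesis
    using assms(2) by (simp add: real_integrable_def less_top)
qed

text \<open>The logarithm of \<open>eq\<close> reads ln \<open>\<gamma>\<close> + ln
  \<open>\<beta>\<close> = ln \<open>\<alpha>\<close> + ln \<open>\<delta>\<close>, and ln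
  \<open>\<delta>\<close> \<le> \<open>\<delta>\<close> - 1 has nonpositive mean. It is applied with
  \<open>\<alpha>\<close> = p / q, \<open>\<beta>\<close> = P / Q, \<open>\<gamma>\<close> = p / r.
  The finiteness assumptions make all three logarithms integrable, so the means may be
  subtracted.\<close>

lemma ext_integral_ext_ln_add_le:
  fixes \<alpha> \<beta> \<gamma> \<delta> :: "'z \<Rightarrow> ennreal"
  assumes M: "prob_space M"
    and [measurable]: "\<alpha> \<in> borel_measurable M" "\<beta> \<in> borel_measurable M"
      "\<gamma> \<in> borel_measurable M" "\<delta> \<in> borel_measurable M"
    and fin: "AE z in M. \<alpha> z \<noteq> 0 \<and> \<alpha> z \<noteq> \<infinity>" "AE z in M. \<beta> z \<noteq> 0 \<and> \<beta> z \<noteq> \<infinity>"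
      "AE z in M. \<gamma> z \<noteq> 0 \<and> \<gamma> z \<noteq> \<infinity>"
    and eq: "AE z in M. \<gamma> z * \<beta> z = \<alpha> z * \<delta> z"
    and \<delta>: "(\<integral>\<^sup>+z. \<delta> z \<partial>M) \<le> 1"
    and neg: "(\<integral>\<^sup>+z. e2ennreal (- ext_ln (\<alpha> z)) \<partial>M) < \<infinity>"
      "(\<integral>\<^sup>+z. e2ennreal (- ext_ln (\<beta> z)) \<partial>M) < \<infinity>"
      "(\<integral>\<^sup>+z. e2ennreal (- ext_ln (\<gamma> z)) \<partial>M) < \<infinity>"
    and \<alpha>: "(\<integral>\<^sup>+z. e2ennreal (ext_ln (\<alpha> z)) \<partial>M) < \<infinity>"
  shows "ext_integral M (\<lambda>z. ext_ln (\<gamma> z))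
    \<le> ext_integral M (\<lambda>z. ext_ln (\<alpha> z)) - ext_integral M (\<lambda>z. ext_ln (\<beta> z))"
proof -
  interpret prob_space M by fact
  define a b c g where "a = (\<lambda>z. real_ln (\<alpha> z))" and "b = (\<lambda>z. real_ln (\<beta> z))"
    and "c = (\<lambda>z. real_ln (\<gamma> z))" and "g = (\<lambda>z. enn2real (\<delta> z) - 1)"
  note defs = a_def b_def c_def g_def
  have [measurable]: "a \<in> borel_measurable M" "b \<in> borel_measurable M" "c \<in> borel_measurable M"
    unfolding defs by measurable
  have ext: "ext_ln x = ereal (real_ln x)" if "x \<noteq> 0 \<and> x \<noteq> \<infinity>" for x
    using that by (simp add: ext_ln_def real_ln_def)
  have A: "AE z in M. ext_ln (\<alpha> z) = ereal (a z)" and B: "AE z in M. ext_ln (\<beta> z) = ereal (b z)"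
    and C: "AE z in M. ext_ln (\<gamma> z) = ereal (c z)"
    using fin unfolding defs by (auto simp: ext)
  have nA: "(\<integral>\<^sup>+z. ennreal (- a z) \<partial>M) < \<infinity>"
    using neg(1) A by (subst nn_integral_cong_AE[where v = "\<lambda>z. e2ennreal (- ext_ln (\<alpha> z))"]) auto
  have nB: "(\<integral>\<^sup>+z. ennreal (- b z) \<partial>M) < \<infinity>"
    using neg(2) B by (subst nn_integral_cong_AE[where v = "\<lambda>z. e2ennreal (- ext_ln (\<beta> z))"]) auto
  have nC: "(\<integral>\<^sup>+z. ennreal (- c z) \<partial>M) < \<infinity>"
    using neg(3) C by (subst nn_integral_cong_AE[where v = "\<lambda>z. e2ennreal (- ext_ln (\<gamma> z))"]) auto
  have pA: "(\<integral>\<^sup>+z. ennreal (a z) \<partial>M) < \<infinity>"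
    using \<alpha> A by (subst nn_integral_cong_AE[where v = "\<lambda>z. e2ennreal (ext_ln (\<alpha> z))"]) auto
  have ia: "integrable M a"
    using nA pA by (auto simp: real_integrable_def)
  have d: "AE z in M. \<delta> z \<noteq> \<infinity>"
    using \<delta> by (intro nn_integral_PInf_AE) (auto simp: top_unique)
  have dint: "(\<integral>\<^sup>+z. ennreal (enn2real (\<delta> z)) \<partial>M) \<le> 1"
    using d \<delta> by (subst nn_integral_cong_AE[where v = \<delta>]) (auto simp: less_top)
  have id: "integrable M (\<lambda>z. enn2real (\<delta> z))"
    by (rule integrableI_nonneg) (use dint in \<open>auto simp: less_top[symmetric] top_unique\<close>)
  have ig: "integrable M g"
    using id unfolding g_def by simp
  have "(\<integral>z. enn2real (\<delta> z) \<partial>M) \<le> 1"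
    using dint by (subst integral_eq_nn_integral) (auto intro: enn2real_leI)
  then have gle: "(\<integral>z. g z \<partial>M) \<le> 0"
    using id unfolding g_def by (simp add: prob_space)
  have le: "AE z in M. c z + b z \<le> a z + g z"
    using fin d eq
  proof eventually_elim
    case (elim z)
    obtain x y u v where *: "\<alpha> z = ennreal x" "\<beta> z = ennreal y" "\<gamma> z = ennreal u" "\<delta> z = ennreal v"
      "0 < x" "0 < y" "0 < u" "0 \<le> v"
      using elim by (cases "\<alpha> z"; cases "\<beta> z"; cases "\<gamma> z"; cases "\<delta> z") (auto simp: less_le)
    then have xy: "u * y = x * v"
      using elim by (simp add: ennreal_mult[symmetric])
    with * have "0 < v"
      by (metis less_le mult_eq_0_iff mult_pos_pos)
    then have "ln u + ln y = ln x + ln v"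
      using * xy by (metis ln_mult_pos)
    moreover have "ln v \<le> v - 1"
      using \<open>0 < v\<close> by (rule ln_le_minus_one)
    ultimately show ?case
      using * by (simp add: defs real_ln_def)
  qed
  have negI: "integrable M (\<lambda>z. max 0 (- f z))"
    if "f \<in> borel_measurable M" "(\<integral>\<^sup>+z. ennreal (- f z) \<partial>M) < \<infinity>" for f :: "'z \<Rightarrow> real"
  proof -
    have "ennreal (max 0 x) = ennreal x" for x
      by (simp add: max_def ennreal_neg)
    with that show ?thesis
      by (intro integrableI_nonneg) auto
  qed
  \<comment> \<open>Only the negative part of \<open>c\<close> is controlled so far, so
    \<open>c\<close> is moved to the right of \<open>le\<close> and \<open>- c\<close> is bounded by
    its positive part.\<close>
  have ib: "integrable M b"
    by (rule integrable_sandwich[where u = "\<lambda>z. a z + g z + max 0 (- c z)"])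
      (use nB nC ia ig negI le in auto)
  \<comment> \<open>Once \<open>b\<close> is integrable, \<open>le\<close> bounds \<open>c\<close>
    above by an integrable function.\<close>
  have ic: "integrable M c"
    by (rule integrable_sandwich[where u = "\<lambda>z. a z + g z - b z"])
      (use nC ia ig ib le in auto)
  have "(\<integral>z. c z + b z \<partial>M) \<le> (\<integral>z. a z + g z \<partial>M)"
    using le ia ib ic ig by (intro integral_mono_AE) auto
  then have "(\<integral>z. c z \<partial>M) \<le> (\<integral>z. a z \<partial>M) - (\<integral>z. b z \<partial>M)"
    using ia ib ic ig gle by simp
  then show ?thesis
    using ext_integral_ereal[OF _ ia A] ext_integral_ereal[OF _ ib B] ext_integral_ereal[OF _ ic C]
    by simp
qed

section \<open>The joint law and the inequality for the averaged posterior\<close>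

text \<open>Conditional Jensen under the joint law of observation and state. The assumption
  \<open>supp\<close> ensures that \<open>P / Q\<close> is not infinite because of a vanishing
  \<open>Q\<close> at points that the joint law charges.\<close>

lemma KL_averaged_posterior_le:
  fixes p q :: "'a::euclidean_space \<Rightarrow> real" and k :: "'b::euclidean_space \<Rightarrow> 'a \<Rightarrow> real"
  defines "P \<equiv> marginal k p" and "Q \<equiv> marginal k q"
  assumes p: "prob_density p" and q: "prob_density q" and k: "cond_density k"
    and supp: "\<And>x y. k y x > 0 \<Longrightarrow> P y \<noteq> 0 \<Longrightarrow> Q y \<noteq> 0"
    and KL: "\<not> (KL (\<lambda>x. ennreal (p x)) (\<lambda>x. ennreal (q x)) = \<infinity> \<and> KL P Q = \<infinity>)"
  shows "KL (\<lambda>x. ennreal (p x)) (averaged_posterior k q p)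
    \<le> KL (\<lambda>x. ennreal (p x)) (\<lambda>x. ennreal (q x)) - KL P Q"
proof (cases "KL (\<lambda>x. ennreal (p x)) (\<lambda>x. ennreal (q x)) = \<infinity>")
  case True
  \<comment> \<open>Here \<open>KL P Q\<close> is not \<open>\<infinity>\<close>, so the right-hand
    side is \<open>\<infinity>\<close>.\<close>
  with KL show ?thesis by (cases "KL P Q") auto
next
  case False
  have [measurable]: "p \<in> borel_measurable borel" "q \<in> borel_measurable borel"
    "(\<lambda>(y, x). k y x) \<in> borel_measurable (borel \<Otimes>\<^sub>M borel)"
    using p q k by (auto simp: prob_density_def cond_density_def)
  have [measurable]: "(\<lambda>z. k (f z) (g z)) \<in> borel_measurable N"
    if "f \<in> borel_measurable N" "g \<in> borel_measurable N" for f g and N :: "'z measure"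
    using measurable_compose[of "\<lambda>z. (f z, g z)" N "borel \<Otimes>\<^sub>M borel" "\<lambda>(y, x). k y x" borel] that
    by simp
  have int: "(\<integral>\<^sup>+x. ennreal (p x) \<partial>lborel) = 1" "(\<integral>\<^sup>+x. ennreal (q x) \<partial>lborel) = 1"
    "\<And>x. (\<integral>\<^sup>+y. ennreal (k y x) \<partial>lborel) = 1"
    using p q k by (auto simp: prob_density_def cond_density_def)
  have PQ_eq: "P = (\<lambda>y. \<integral>\<^sup>+x. ennreal (k y x) * ennreal (p x) \<partial>lborel)"
    "Q = (\<lambda>y. \<integral>\<^sup>+x. ennreal (k y x) * ennreal (q x) \<partial>lborel)"
    unfolding P_def Q_def marginal_def by auto
  have [measurable]: "P \<in> borel_measurable borel" "Q \<in> borel_measurable borel"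
    unfolding PQ_eq by measurable

  \<comment> \<open>\<open>w\<close> is the factor by which averaging the posterior corrects the
    surrogate \<open>q\<close>.\<close>
  define w where "w x = (\<integral>\<^sup>+y. ennreal (k y x) * (P y / Q y) \<partial>lborel)" for x
  define r where "r x = ennreal (q x) * w x" for x
  have [measurable]: "w \<in> borel_measurable borel"
    unfolding w_def by measurable
  have [measurable]: "r \<in> borel_measurable borel"
    unfolding r_def by measurable
  have r: "averaged_posterior k q p = r"
    unfolding averaged_posterior_def posterior_def r_def w_def PQ_eq marginal_def
    by (subst nn_integral_cmult[symmetric])
      (auto simp: divide_ennreal_def mult_ac intro!: nn_integral_cong ext)

  define \<mu> where
    "\<mu> = density (lborel \<Otimes>\<^sub>M lborel) (\<lambda>(y, x). ennreal (k y x) * ennreal (p x))"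
  have [measurable_cong]: "sets \<mu> = sets (borel \<Otimes>\<^sub>M borel)"
    unfolding \<mu>_def by simp
  have nn_\<mu>: "(\<integral>\<^sup>+z. f (fst z) (snd z) \<partial>\<mu>)
      = (\<integral>\<^sup>+x. ennreal (p x) * (\<integral>\<^sup>+y. ennreal (k y x) * f y x \<partial>lborel) \<partial>lborel)"
    if [measurable]: "(\<lambda>z. f (fst z) (snd z)) \<in> borel_measurable (borel \<Otimes>\<^sub>M borel)" for f
  proof -
    have [measurable]: "(\<lambda>y. f y x) \<in> borel_measurable borel" for x
      using measurable_compose[OF measurable_Pair2'[of x borel borel] that] by simp
    show ?thesis
      unfolding \<mu>_def
      by (subst nn_integral_density, measurable)
        (simp add: lborel_pair.nn_integral_snd[symmetric] nn_integral_cmult[symmetric]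
          case_prod_beta mult_ac)
  qed
  have [measurable]: "fst \<in> measurable \<mu> borel" "snd \<in> measurable \<mu> borel"
    by measurable
  have distr_snd: "distr \<mu> lborel snd = density lborel (\<lambda>x. ennreal (p x))"
  proof (rule measure_eqI)
    fix A assume "A \<in> sets (distr \<mu> lborel snd)"
    then have [measurable]: "A \<in> sets borel" by simp
    have "emeasure (distr \<mu> lborel snd) A = (\<integral>\<^sup>+z. indicator A (snd z) \<partial>\<mu>)"
      by (simp add: nn_integral_indicator[symmetric] nn_integral_distr del: nn_integral_indicator)
    also have "\<dots> = emeasure (density lborel (\<lambda>x. ennreal (p x))) A"
      by (subst nn_\<mu>) (auto simp: nn_integral_multc int emeasure_density)
    finally show "emeasure (distr \<mu> lborel snd) A = emeasure (density lborel (\<lambda>x. ennreal (p x))) A" .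
  qed simp
  have swap: "(\<integral>\<^sup>+y. (\<integral>\<^sup>+x. ennreal (k y x) * ennreal (g x) \<partial>lborel) * h y \<partial>lborel)
      = (\<integral>\<^sup>+x. ennreal (g x) * (\<integral>\<^sup>+y. ennreal (k y x) * h y \<partial>lborel) \<partial>lborel)"
    if [measurable]: "g \<in> borel_measurable borel" "h \<in> borel_measurable borel" for g h
  proof -
    have "(\<integral>\<^sup>+y. (\<integral>\<^sup>+x. ennreal (k y x) * ennreal (g x) \<partial>lborel) * h y \<partial>lborel)
        = (\<integral>\<^sup>+y. \<integral>\<^sup>+x. ennreal (g x) * (ennreal (k y x) * h y) \<partial>lborel \<partial>lborel)"
      by (simp add: nn_integral_cmult[symmetric] mult_ac)
    also have "\<dots> = (\<integral>\<^sup>+x. \<integral>\<^sup>+y. ennreal (g x) * (ennreal (k y x) * h y) \<partial>lborel \<partial>lborel)"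
      by (rule lborel_pair.Fubini') measurable
    finally show ?thesis
      by (simp add: nn_integral_cmult)
  qed
  have distr_fst: "distr \<mu> lborel fst = density lborel P"
  proof (rule measure_eqI)
    fix A assume "A \<in> sets (distr \<mu> lborel fst)"
    then have [measurable]: "A \<in> sets borel" by simp
    have "emeasure (distr \<mu> lborel fst) A = (\<integral>\<^sup>+z. indicator A (fst z) \<partial>\<mu>)"
      by (simp add: nn_integral_indicator[symmetric] nn_integral_distr del: nn_integral_indicator)
    also have "\<dots> = (\<integral>\<^sup>+x. ennreal (p x) * (\<integral>\<^sup>+y. ennreal (k y x) * indicator A y \<partial>lborel) \<partial>lborel)"
      by (rule nn_\<mu>) measurable
    also have "\<dots> = emeasure (density lborel P) A"
      by (simp add: emeasure_density PQ_eq swap)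
    finally show "emeasure (distr \<mu> lborel fst) A = emeasure (density lborel P) A" .
  qed simp
  have intP: "(\<integral>\<^sup>+y. P y \<partial>lborel) = 1" and intQ: "(\<integral>\<^sup>+y. Q y \<partial>lborel) = 1"
    using swap[of p "\<lambda>_. 1"] swap[of q "\<lambda>_. 1"] unfolding PQ_eq by (simp_all add: int)
  \<comment> \<open>Only an inequality, because \<open>Q y * (P y / Q y)\<close> is 0 where
    \<open>Q y\<close> is 0 or \<open>\<infinity>\<close>. A mass of at most 1 is enough to bound
    the negative part of ln (p / r).\<close>
  have intr: "(\<integral>\<^sup>+x. r x \<partial>lborel) \<le> 1"
  proof -
    have "(\<integral>\<^sup>+x. r x \<partial>lborel) = (\<integral>\<^sup>+y. Q y * (P y / Q y) \<partial>lborel)"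
      unfolding r_def w_def PQ_eq(2) by (rule swap[symmetric]) auto
    also have "\<dots> \<le> (\<integral>\<^sup>+y. P y \<partial>lborel)"
      by (intro nn_integral_mono ennreal_mult_divide_le)
    finally show ?thesis by (simp add: intP)
  qed
  have prob: "prob_space \<mu>"
  proof
    have "emeasure \<mu> (space \<mu>) = (\<integral>\<^sup>+z. 1 \<partial>\<mu>)" by simp
    also have "\<dots> = 1" by (subst nn_\<mu>) (auto simp: int)
    finally show "emeasure \<mu> (space \<mu>) = 1" .
  qed

  \<comment> \<open>Through the marginals, a property of one coordinate need only be checked
    Lebesgue-almost everywhere where the marginal density is positive.\<close>
  have AEx: "AE z in \<mu>. R (snd z)"
    if "AE x in lborel. p x > 0 \<longrightarrow> R x" for R
  proof -
    have "AE x in distr \<mu> lborel snd. R x"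
      unfolding distr_snd using that by (simp add: AE_density)
    then show ?thesis
      by (rule AE_distrD[rotated]) simp
  qed
  have AEy: "AE z in \<mu>. R (fst z)"
    if "AE y in lborel. P y > 0 \<longrightarrow> R y" for R
  proof -
    have "AE y in distr \<mu> lborel fst. R y"
      unfolding distr_fst using that by (simp add: AE_density)
    then show ?thesis
      by (rule AE_distrD[rotated]) simp
  qed
  have pos: "AE z in \<mu>. p (snd z) > 0 \<and> k (fst z) (snd z) > 0"
    unfolding \<mu>_def by (subst AE_density) (auto simp: case_prod_beta ennreal_zero_less_mult_iff)
  have P0: "AE z in \<mu>. P (fst z) \<noteq> 0"
    by (rule AEy) auto
  have Pfin: "AE z in \<mu>. P (fst z) \<noteq> \<infinity>"
    using nn_integral_PInf_AE[of P lborel] intP by (intro AEy) auto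
  have Qfin: "AE z in \<mu>. Q (fst z) \<noteq> \<infinity>"
    using nn_integral_PInf_AE[of Q lborel] intQ by (intro AEy) auto
  have rfin: "AE z in \<mu>. r (snd z) \<noteq> \<infinity>"
  proof -
    have "(\<integral>\<^sup>+x. r x \<partial>lborel) \<noteq> \<infinity>"
      using intr by (auto simp: top_unique)
    then show ?thesis
      using nn_integral_PInf_AE[of r lborel] by (intro AEx) auto
  qed
  have \<beta>: "AE z in \<mu>. P (fst z) / Q (fst z) \<noteq> 0 \<and> P (fst z) / Q (fst z) \<noteq> \<infinity>"
    using pos P0 Pfin Qfin
    by eventually_elim (auto simp: ennreal_divide_eq_0_iff ennreal_divide_eq_top_iff dest: supp)
  have w0: "AE z in \<mu>. w (snd z) \<noteq> 0"
  proof -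
    \<comment> \<open>Integrating out \<open>y\<close> first turns \<open>P / Q\<close> into
      \<open>w\<close>, which vanishes on the set in question. So \<open>P / Q\<close> is almost
      everywhere 0 there, and by \<open>\<beta>\<close> this set is null.\<close>
    let ?f = "\<lambda>z. indicator {x. w x = 0} (snd z) * (P (fst z) / Q (fst z))"
    have "(\<integral>\<^sup>+z. ?f z \<partial>\<mu>)
        = (\<integral>\<^sup>+x. ennreal (p x) * (\<integral>\<^sup>+y. indicator {x. w x = 0} x * (ennreal (k y x) * (P y / Q y)) \<partial>lborel) \<partial>lborel)"
      by (subst nn_\<mu>) (auto simp: mult_ac)
    also have "\<dots> = (\<integral>\<^sup>+x. ennreal (p x) * (indicator {x. w x = 0} x * w x) \<partial>lborel)"
      by (simp add: nn_integral_cmult w_def)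
    also have "\<dots> = 0"
      by (simp add: nn_integral_0_iff_AE indicator_def)
    finally have "AE z in \<mu>. ?f z = 0"
      by (subst (asm) nn_integral_0_iff_AE) auto
    then show ?thesis
      using \<beta> by eventually_elim (auto simp: indicator_def)
  qed

  have KLx: "KL (\<lambda>x. ennreal (p x)) s = ext_integral \<mu> (\<lambda>z. ext_ln (ennreal (p (snd z)) / s (snd z)))"
    if [measurable]: "s \<in> borel_measurable borel" for s
    unfolding KL_def
    by (subst ext_integral_density[symmetric])
      (auto simp: distr_snd[symmetric] ext_integral_distr)
  have KLy: "KL P Q = ext_integral \<mu> (\<lambda>z. ext_ln (P (fst z) / Q (fst z)))"
    unfolding KL_def
    by (subst ext_integral_density[symmetric])
      (auto simp: distr_fst[symmetric] ext_integral_distr)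
  have negx: "(\<integral>\<^sup>+z. e2ennreal (- ext_ln (ennreal (p (snd z)) / s (snd z))) \<partial>\<mu>) < \<infinity>"
    if [measurable]: "s \<in> borel_measurable borel" and "(\<integral>\<^sup>+x. s x \<partial>lborel) \<le> 1" for s
  proof -
    have "(\<integral>\<^sup>+z. e2ennreal (- ext_ln (ennreal (p (snd z)) / s (snd z))) \<partial>\<mu>)
      = (\<integral>\<^sup>+x. e2ennreal (- ext_ln (ennreal (p x) / s x)) \<partial>density lborel (\<lambda>x. ennreal (p x)))"
      unfolding distr_snd[symmetric] by (simp add: nn_integral_distr)
    also have "\<dots> \<le> (\<integral>\<^sup>+x. s x \<partial>lborel)"
      by (rule nn_integral_neg_ext_ln_le) auto
    finally show ?thesis
      using that(2) by (auto simp: less_top[symmetric] top_unique)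
  qed
  have negy: "(\<integral>\<^sup>+z. e2ennreal (- ext_ln (P (fst z) / Q (fst z))) \<partial>\<mu>) < \<infinity>"
  proof -
    have "(\<integral>\<^sup>+z. e2ennreal (- ext_ln (P (fst z) / Q (fst z))) \<partial>\<mu>)
      = (\<integral>\<^sup>+y. e2ennreal (- ext_ln (P y / Q y)) \<partial>density lborel P)"
      unfolding distr_fst[symmetric] by (simp add: nn_integral_distr)
    also have "\<dots> \<le> (\<integral>\<^sup>+y. Q y \<partial>lborel)"
      by (rule nn_integral_neg_ext_ln_le) auto
    finally show ?thesis
      using intQ by (auto simp: less_top[symmetric] top_unique)
  qed
  have neg\<alpha>: "(\<integral>\<^sup>+z. e2ennreal (- ext_ln (ennreal (p (snd z)) / ennreal (q (snd z)))) \<partial>\<mu>) < \<infinity>"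
    by (rule negx) (auto simp: int)
  \<comment> \<open>With a finite negative part, an infinite positive part would make the distance
    from \<open>p\<close> to \<open>q\<close> infinite, which this case excludes.\<close>
  have pos\<alpha>: "(\<integral>\<^sup>+z. e2ennreal (ext_ln (ennreal (p (snd z)) / ennreal (q (snd z)))) \<partial>\<mu>) < \<infinity>"
  proof (rule ccontr)
    assume "\<not> ?thesis"
    then have "KL (\<lambda>x. ennreal (p x)) (\<lambda>x. ennreal (q x)) = \<infinity>"
      using neg\<alpha>
      by (cases "\<integral>\<^sup>+z. e2ennreal (- ext_ln (ennreal (p (snd z)) / ennreal (q (snd z)))) \<partial>\<mu>")
        (simp_all add: KLx ext_integral_def less_top[symmetric])
    with False show False by simp
  qed
  \<comment> \<open>Where \<open>q\<close> vanishes and \<open>p\<close> is positive the log-ratio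
    is \<open>\<infinity>\<close>, which \<open>pos\<alpha>\<close> allows only on a null
    set.\<close>
  have q0: "AE z in \<mu>. q (snd z) > 0"
  proof -
    have "AE z in \<mu>. e2ennreal (ext_ln (ennreal (p (snd z)) / ennreal (q (snd z)))) \<noteq> \<infinity>"
      using pos\<alpha> by (intro nn_integral_PInf_AE) auto
    with pos show ?thesis
    proof eventually_elim
      case (elim z)
      show ?case
      proof (rule ccontr)
        assume "\<not> ?thesis"
        then have "ennreal (q (snd z)) = 0" by (simp add: ennreal_eq_0_iff)
        with elim show False by (simp add: ext_ln_def ennreal_divide_zero ennreal_eq_0_iff)
      qed
    qed
  qed

  text \<open>
    Pointwise \<open>ln (p / r) + ln (P / Q) = ln (p / q) + ln \<delta>\<close> for \<open>\<delta> = (P / Q) / w\<close>. Given \<open>x\<close>,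
    \<open>\<delta>\<close> is a random variable divided by its own mean, so \<open>ln \<delta> \<le> \<delta> - 1\<close> integrates to
    a nonpositive bound.
  \<close>
  have "ext_integral \<mu> (\<lambda>z. ext_ln (ennreal (p (snd z)) / r (snd z)))
    \<le> ext_integral \<mu> (\<lambda>z. ext_ln (ennreal (p (snd z)) / ennreal (q (snd z))))
      - ext_integral \<mu> (\<lambda>z. ext_ln (P (fst z) / Q (fst z)))"
  proof (rule ext_integral_ext_ln_add_le[where \<delta> = "\<lambda>z. P (fst z) / Q (fst z) / w (snd z)"])
    show "AE z in \<mu>. ennreal (p (snd z)) / ennreal (q (snd z)) \<noteq> 0 \<and>
        ennreal (p (snd z)) / ennreal (q (snd z)) \<noteq> \<infinity>"
      using pos q0 by eventually_elim (simp add: divide_ennreal ennreal_eq_0_iff not_le)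
    show "AE z in \<mu>. ennreal (p (snd z)) / r (snd z) \<noteq> 0 \<and> ennreal (p (snd z)) / r (snd z) \<noteq> \<infinity>"
      using pos q0 w0 rfin
      by eventually_elim
        (auto simp: ennreal_divide_eq_0_iff ennreal_divide_eq_top_iff r_def ennreal_eq_0_iff)
    show "AE z in \<mu>. ennreal (p (snd z)) / r (snd z) * (P (fst z) / Q (fst z))
        = ennreal (p (snd z)) / ennreal (q (snd z)) * (P (fst z) / Q (fst z) / w (snd z))"
      using q0 w0
      by eventually_elim
        (simp add: r_def divide_ennreal_def ennreal_inverse_mult' zero_less_iff_neq_zero mult_ac
          ennreal_eq_0_iff)
    have "(\<integral>\<^sup>+z. P (fst z) / Q (fst z) / w (snd z) \<partial>\<mu>)
        = (\<integral>\<^sup>+x. ennreal (p x) * (\<integral>\<^sup>+y. ennreal (k y x) * (P y / Q y) * inverse (w x) \<partial>lborel) \<partial>lborel)"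
      by (subst nn_\<mu>) (auto simp: divide_ennreal_def mult_ac)
    also have "\<dots> = (\<integral>\<^sup>+x. ennreal (p x) * (w x / w x) \<partial>lborel)"
      by (simp add: nn_integral_multc w_def divide_ennreal_def)
    \<comment> \<open>The quotient \<open>w x / w x\<close> is 1, or 0 when \<open>w x\<close> is 0
      or \<open>\<infinity>\<close>.\<close>
    also have "\<dots> \<le> (\<integral>\<^sup>+x. ennreal (p x) * 1 \<partial>lborel)"
      using ennreal_mult_divide_le[of _ 1]
      by (intro nn_integral_mono mult_left_mono) (auto simp: divide_ennreal_def)
    finally show "(\<integral>\<^sup>+z. P (fst z) / Q (fst z) / w (snd z) \<partial>\<mu>) \<le> 1"
      by (simp add: int)
    show "(\<integral>\<^sup>+z. e2ennreal (- ext_ln (ennreal (p (snd z)) / r (snd z))) \<partial>\<mu>) < \<infinity>"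
      by (rule negx) (auto simp: intr)
  qed (use prob \<beta> neg\<alpha> negy pos\<alpha> in auto)
  then show ?thesis
    unfolding r by (simp add: KLx KLy)
qed

section \<open>Specialization to matrix-valued states and observations\<close>

theorem proposition1:
  fixes pX pX_sur :: "real ^ 'T ^ 'n \<Rightarrow> real"
    and pYX :: "real ^ 'T ^ 'm \<Rightarrow> real ^ 'T ^ 'n \<Rightarrow> real"
  defines "pY \<equiv> marginal pYX pX"
    and "pY_hat \<equiv> marginal pYX pX_sur"
    and "pX_hat \<equiv> averaged_posterior pYX pX_sur pX"
  assumes "prob_density pX"
    and "prob_density pX_sur"
    and "cond_density pYX"
    and "\<And>x. support_on UNIV (\<lambda>y. ennreal (pYX y x) * pY y) \<subseteq> support_on UNIV pY_hat"
    and "support_on UNIV pY_hat \<subseteq> support_on UNIV pY"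
    and "\<not> (KL (\<lambda>x. ennreal (pX x)) (\<lambda>x. ennreal (pX_sur x)) = \<infinity> \<and> KL pY pY_hat = \<infinity>)"
  shows "KL (\<lambda>x. ennreal (pX x)) pX_hat
           \<le> KL (\<lambda>x. ennreal (pX x)) (\<lambda>x. ennreal (pX_sur x)) - KL pY pY_hat"
  unfolding pY_def pY_hat_def pX_hat_def
proof (rule KL_averaged_posterior_le)
  fix x y
  assume "pYX y x > 0" "marginal pYX pX y \<noteq> 0"
  \<comment> \<open>The product of \<open>pYX y x\<close> and \<open>pY y\<close> is nonzero, so the
    first support inclusion puts \<open>y\<close> in the support of \<open>pY_hat\<close>.\<close>
  then show "marginal pYX pX_sur y \<noteq> 0"
    using assms(7)[of x] unfolding pY_def pY_hat_def
    by (auto simp: support_on_def subset_iff ennreal_eq_0_iff)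
qed (use assms in auto)

end
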